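(* Let $k$ be a positive integer that is not a power of $2$, and let $n$ be a positive integer. The equation $\sum_{i=1}^n \frac{1}{x_i}=1$, $x_1\leq\dotsb\leq x_n$, has a nontrivial solution with every $x_i\in S(k)$ if and only if $(k,n)=(3,3)$ or \[ n\geq\begin{cases} (k+8)/4 & \text{for } k\equiv0\pmod{4},\\ (k+11)/4 & \text{for } k\equiv1\pmod{4},\\ (k+10)/4 & \text{for } k\equiv2\pmod{4},\\ (k+13)/4 & \text{for } k\equiv3\pmod{4}. \end{cases} \]
   Context: For a positive integer $k$ that is not a power of $2$ (note that $1=2^0$ is a power of $2$, so $k\geq 3$), let $S(k)=\{2^ak^b\mid a\in\{0,1,2\},\ b\in\mathbb{Z}_{\geq0}\}$. The $x_i$ are not required to be distinct. A solution with every $x_i\in S(k)$ is called nontrivial if $k$ divides some $x_i$; equivalently, writing each $x_i$ uniquely as $2^{a_i}k^{b_i}$ with $a_i\in\{0,1,2\}$ and $b_i\geq 0$, some $b_i\geq1$. *)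

theory Defs
  imports Complex_Main
begin

definition S :: "nat \<Rightarrow> nat set" where
  "S k = {2 ^ a * k ^ b | a b :: nat. a \<in> {0, 1, 2}}"

text \<open>Only the values of \<open>x\<close> on \<open>{1..n}\<close> matter.\<close>

definition is_solution :: "nat \<Rightarrow> nat \<Rightarrow> (nat \<Rightarrow> nat) \<Rightarrow> bool" where
  "is_solution k n x \<longleftrightarrow>
     (\<forall>i\<in>{1..n}. x i \<in> S k) \<and> mono_on {1..n} x \<and> (\<Sum>i=1..n. 1 / real (x i)) = 1"

definition nontrivial_solution :: "nat \<Rightarrow> nat \<Rightarrow> (nat \<Rightarrow> nat) \<Rightarrow> bool" where
  "nontrivial_solution k n x \<longleftrightarrow> is_solution k n x \<and> (\<exists>i\<in>{1..n}. k dvd x i)"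

end

theory Submission
  imports Defs "HOL-Library.Multiset" "HOL-Computational_Algebra.Primes"
begin

text \<open>
  Group the terms of a solution by their power of \<open>k\<close>: those with exponent \<open>b\<close> contribute
  \<open>T b / (4 * k ^ b)\<close>, where \<open>T b\<close> is a sum of parts from \<open>{1, 2, 4}\<close>, so the equation
  becomes \<open>(\<Sum>b. T b / k ^ b) = 4\<close>. At the highest occurring exponent \<open>B\<close> we have \<open>k dvd T B\<close>,
  and moving \<open>T B = j * k\<close> down to \<open>j\<close> units at exponent \<open>B - 1\<close> does not
  increase the least possible number of parts. This reduces the lower bound to \<open>B = 1\<close>, where
  \<open>T 1 = j * k\<close> and \<open>T 0 = 4 - j\<close>; the optimum is \<open>j = 1\<close>, except that \<open>j = 2\<close> wins for \<open>k = 3\<close>.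
  Conversely, starting from \<open>1/2 + 1/4 + k/(4 * k)\<close> one reaches all larger lengths by splitting
  parts and by repeatedly expanding some \<open>1/(4 * k ^ b)\<close> as \<open>k / (4 * k ^ (b + 1))\<close>.
\<close>

section \<open>Counting parts from {1, 2, 4}\<close>

text \<open>The least number of parts from \<open>{1, 2, 4}\<close> with sum \<open>t\<close>.\<close>

definition min_parts :: "nat \<Rightarrow> nat" where
  "min_parts t = t div 4 + (t mod 4 + 1) div 2"

lemma min_parts_0 [simp]: "min_parts 0 = 0"
  by (simp add: min_parts_def)

lemma min_parts_bounds: "t \<le> 4 * min_parts t" "4 * min_parts t \<le> t + 5"
proof -
  have "t = 4 * (t div 4) + t mod 4" "t mod 4 < 4" by simp_all
  then show "t \<le> 4 * min_parts t" "4 * min_parts t \<le> t + 5"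
    unfolding min_parts_def by presburger+
qed

lemma min_parts_add_mult_4 [simp]: "min_parts (4 * q + t) = q + min_parts t"
  by (simp add: min_parts_def)

lemma less_4_cases:
  assumes "(r::nat) < 4"
  obtains "r = 0" | "r = 1" | "r = 2" | "r = 3"
  using assms by linarith

text \<open>Multiples of 4 split off exactly on both sides, which leaves sixteen pairs of residues
  to check.\<close>

lemma min_parts_add_le: "min_parts (s + t) \<le> min_parts s + min_parts t"
proof -
  have small: "min_parts (r + u) \<le> min_parts r + min_parts u" if "r < 4" "u < 4" for r u
    using that by (elim less_4_cases) (simp_all add: min_parts_def)
  have "s + t = 4 * (s div 4 + t div 4) + (s mod 4 + t mod 4)" by simp
  then have "min_parts (s + t) = s div 4 + t div 4 + min_parts (s mod 4 + t mod 4)"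
    by (metis min_parts_add_mult_4)
  moreover have "min_parts s = s div 4 + min_parts (s mod 4)"
    "min_parts t = t div 4 + min_parts (t mod 4)"
    by (simp_all add: min_parts_def)
  ultimately show ?thesis using small[of "s mod 4" "t mod 4"] by simp
qed

lemma min_parts_sum_le:
  assumes "finite A"
  shows "min_parts (\<Sum>i\<in>A. w i) \<le> (\<Sum>i\<in>A. min_parts (w i))"
  using assms
proof (induction rule: finite_induct)
  case (insert i A)
  then show ?case
    using min_parts_add_le[of "w i" "sum w A"] by simp
qed simp

text \<open>\<open>min_parts\<close> is not monotone (3 needs two parts, 4 only one), so
  \<open>j \<le> j * k\<close> is not enough. For j at least 3 the linear bounds suffice, since j +
  5 \<le> 3j; for smaller j at most one part is needed.\<close>

lemma min_parts_le_mult: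
  assumes "k \<ge> 3"
  shows "min_parts j \<le> min_parts (j * k)"
proof (cases "j \<ge> 3")
  case True
  have "3 * j \<le> j * k" using assms by simp
  then show ?thesis
    using True min_parts_bounds(2)[of j] min_parts_bounds(1)[of "j * k"] by linarith
next
  case False
  then have "min_parts j \<le> 1" by (auto simp: min_parts_def)
  then show ?thesis
    using False assms min_parts_bounds(1)[of "j * k"] by (cases "min_parts (j * k) = 0") auto
qed

section \<open>Lower bound on the length\<close>

definition min_length :: "nat \<Rightarrow> nat" where
  "min_length k = (if k = 3 then 3 else min_parts k + 2)"

text \<open>The summand 2 in \<open>min_length\<close> is \<open>min_parts 3\<close>, the cost of
  exponent 0 when j = 1. Larger j costs at least \<open>j * q\<close> parts at exponent 1, so only
  small k could gain, and a finite check on j and r remains.\<close>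

lemma min_length_le_two_levels:
  assumes "k \<ge> 3" "s + j = 4" "j > 0"
  shows "min_length k \<le> min_parts s + min_parts (j * k)"
proof -
  define q r where "q = k div 4" and "r = k mod 4"
  have k: "k = 4 * q + r" by (simp add: q_def r_def)
  have "j * k = 4 * (j * q) + j * r" by (simp add: k algebra_simps)
  then have jk: "min_parts (j * k) = j * q + min_parts (j * r)" by simp
  have "r < 4" by (simp add: r_def)
  moreover have "j = 1 \<and> s = 3 \<or> j = 2 \<and> s = 2 \<or> j = 3 \<and> s = 1 \<or> j = 4 \<and> s = 0"
    using assms by linarith
  \<comment> \<open>This excludes k \<le> 2, where the inequality fails.\<close>
  moreover have "q > 0 \<or> r = 3" using assms(1) k \<open>r < 4\<close> by linarith
  ultimately show ?thesis
    unfolding min_length_def jk unfolding k min_parts_add_mult_4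
    by (elim less_4_cases disjE conjE) (simp_all add: min_parts_def)
qed

lemma min_length_le_levels:
  fixes T :: "nat \<Rightarrow> nat"
  assumes "k \<ge> 3"
    and "(\<Sum>b\<le>B. T b * k ^ (B - b)) = 4 * k ^ B"
    and "\<exists>b\<in>{1..B}. T b > 0"
  shows "min_length k \<le> (\<Sum>b\<le>B. min_parts (T b))"
  using assms(2,3)
proof (induction B arbitrary: T)
  case (Suc B)
  have "(\<Sum>b\<le>B. T b * k ^ (Suc B - b)) = k * (\<Sum>b\<le>B. T b * k ^ (B - b))"
    unfolding sum_distrib_left by (intro sum.cong) (auto simp: Suc_diff_le)
  with Suc.prems(1)
  have eq: "k * (\<Sum>b\<le>B. T b * k ^ (B - b)) + T (Suc B) = k * (4 * k ^ B)"
    by (simp add: mult_ac)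
  then have "k dvd T (Suc B)"
    by (metis dvd_add_right_iff dvd_triv_left)
  then obtain j where j: "T (Suc B) = j * k"
    by (metis dvd_def mult.commute)
  have "k * ((\<Sum>b\<le>B. T b * k ^ (B - b)) + j) = k * (4 * k ^ B)"
    using eq j by (simp add: algebra_simps)
  then have eq': "(\<Sum>b\<le>B. T b * k ^ (B - b)) + j = 4 * k ^ B"
    using assms(1) by simp
  show ?case
  \<comment> \<open>For B = 0 a carry would leave no positive exponent, so the two-level bound ends
    the induction.\<close>
  proof (cases "B = 0")
    case True
    then show ?thesis
      using min_length_le_two_levels[OF assms(1), of "T 0" j] eq' j Suc.prems(2) by auto
  next
    case False
    define T' where "T' = T(B := T B + j)"
    have split: "{..B} = insert B {..<B}" by auto
    have "(\<Sum>b\<le>B. T' b * k ^ (B - b)) = (\<Sum>b\<le>B. T b * k ^ (B - b)) + j"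
      by (simp add: split T'_def)
    \<comment> \<open>If j = 0, the top level was empty and a lower positive level is occupied;
      otherwise the carry occupies level B.\<close>
    moreover have "\<exists>b\<in>{1..B}. T' b > 0"
    proof (cases "j = 0")
      case True
      then show ?thesis
        using Suc.prems(2) j unfolding T'_def by (auto simp: le_Suc_eq Bex_def)
    next
      case nz: False
      then show ?thesis
        using False unfolding T'_def by (intro bexI[of _ B]) auto
    qed
    ultimately have "min_length k \<le> (\<Sum>b\<le>B. min_parts (T' b))"
      using Suc.IH[of T'] eq' by simp
    also have "\<dots> = (\<Sum>b<B. min_parts (T b)) + min_parts (T B + j)"
      by (simp add: split T'_def)
    also have "\<dots> \<le> (\<Sum>b<B. min_parts (T b)) + (min_parts (T B) + min_parts (j * k))"
      using min_parts_add_le[of "T B" j] min_parts_le_mult[OF assms(1), of j] by simp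
    also have "\<dots> = (\<Sum>b\<le>Suc B. min_parts (T b))"
      by (simp add: split j)
    finally show ?thesis .
  qed
qed auto

lemma nontrivial_solution_imp_min_length_le:
  assumes k: "k \<ge> 3" and npow: "\<not> (\<exists>m::nat. k = 2 ^ m)"
    and sol: "nontrivial_solution k n x"
  shows "min_length k \<le> n"
proof -
  have "\<forall>i\<in>{1..n}. \<exists>p. x i = 2 ^ fst p * k ^ snd p \<and> fst p \<in> {0, 1, 2::nat}"
    using sol unfolding nontrivial_solution_def is_solution_def S_def by fastforce
  then obtain p where p: "\<And>i. i \<in> {1..n} \<Longrightarrow> x i = 2 ^ fst (p i) * k ^ snd (p i)"
    and p2: "\<And>i. i \<in> {1..n} \<Longrightarrow> fst (p i) \<in> {0, 1, 2::nat}"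
    by (metis (no_types, lifting) bchoice)
  define a where "a = (\<lambda>i. fst (p i))"
  define e where "e = (\<lambda>i. snd (p i))"
  have x: "x i = 2 ^ a i * k ^ e i" "a i \<in> {0, 1, 2}" if "i \<in> {1..n}" for i
    using p p2 that by (auto simp: a_def e_def)
  \<comment> \<open>The weight is 4 * k ^ \<open>e i\<close> / \<open>x i\<close>, one of the parts
    4, 2, 1.\<close>
  define w where "w = (\<lambda>i. 2 ^ (2 - a i) :: nat)"
  \<comment> \<open>The sum serves as a common upper bound for the exponents; levels without terms
    have \<open>T b = 0\<close>.\<close>
  define B where "B = (\<Sum>i\<in>{1..n}. e i)"
  have eB: "e i \<le> B" if "i \<in> {1..n}" for i
    unfolding B_def using that by (intro member_le_sum) auto
  define T where "T = (\<lambda>b. \<Sum>i | i \<in> {1..n} \<and> e i = b. w i)"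
  have img: "e ` {1..n} \<subseteq> {..B}" using eB by auto

  have "real (\<Sum>b\<le>B. T b * k ^ (B - b)) =
      (\<Sum>b\<le>B. \<Sum>i | i \<in> {1..n} \<and> e i = b. real (w i) * real k ^ (B - e i))"
    by (simp add: T_def sum_distrib_right)
  also have "\<dots> = (\<Sum>i\<in>{1..n}. real (w i) * real k ^ (B - e i))"
    using img by (intro sum.group) auto
  also have "\<dots> = (\<Sum>i\<in>{1..n}. 4 * real k ^ B * (1 / real (x i)))"
  proof (intro sum.cong refl)
    fix i assume i: "i \<in> {1..n}"
    have "real (w i) = 4 / 2 ^ a i"
      using x(2)[OF i] by (auto simp: w_def)
    moreover have "real k ^ (B - e i) = real k ^ B / real k ^ e i"
      using eB[OF i] k by (intro power_diff) auto
    ultimately show "real (w i) * real k ^ (B - e i) = 4 * real k ^ B * (1 / real (x i))"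
      using x(1)[OF i] by simp
  qed
  also have "\<dots> = 4 * real k ^ B"
    using sol unfolding nontrivial_solution_def is_solution_def sum_distrib_left[symmetric]
    by simp
  finally have "real (\<Sum>b\<le>B. T b * k ^ (B - b)) = real (4 * k ^ B)"
    by simp
  then have total: "(\<Sum>b\<le>B. T b * k ^ (B - b)) = 4 * k ^ B"
    by (rule of_nat_eq_iff[THEN iffD1])

  obtain i where i: "i \<in> {1..n}" and "k dvd x i"
    using sol unfolding nontrivial_solution_def by auto
  \<comment> \<open>Otherwise k would divide a power of 2 and hence be one.\<close>
  have "e i \<noteq> 0"
  proof
    assume "e i = 0"
    then have "k dvd 2 ^ a i" using \<open>k dvd x i\<close> x(1)[OF i] by simp
    then show False
      using npow divides_primepow_nat[of 2 k "a i"] by auto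
  qed
  moreover have "T (e i) > 0"
    unfolding T_def using i by (intro sum_pos2[of _ i]) (auto simp: w_def)
  ultimately have "\<exists>b\<in>{1..B}. T b > 0"
    using eB[OF i] by (intro bexI[of _ "e i"]) auto

  then have "min_length k \<le> (\<Sum>b\<le>B. min_parts (T b))"
    using min_length_le_levels[OF k total] by blast
  also have "\<dots> \<le> (\<Sum>b\<le>B. \<Sum>i | i \<in> {1..n} \<and> e i = b. min_parts (w i))"
    unfolding T_def by (intro sum_mono min_parts_sum_le) auto
  also have "\<dots> = (\<Sum>i\<in>{1..n}. min_parts (w i))"
    using img by (intro sum.group) auto
  also have "\<dots> = (\<Sum>i\<in>{1..n}. 1)"
  proof (intro sum.cong refl)
    fix i assume "i \<in> {1..n}"
    from x(2)[OF this] show "min_parts (w i) = 1"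
      by (auto simp: w_def min_parts_def)
  qed
  also have "\<dots> = n" by simp
  finally show ?thesis .
qed

section \<open>Construction of solutions\<close>

lemma ex_parts:
  assumes "min_parts t \<le> c" "c \<le> t"
  shows "\<exists>c0 c1 c2. c0 + c1 + c2 = c \<and> 4 * c0 + 2 * c1 + c2 = t"
  using assms
proof (induction c rule: dec_induct)
  case base
  have "r div 2 + r mod 2 = (r + 1) div 2" for r :: nat by presburger
  from this[of "t mod 4"]
  have "t div 4 + t mod 4 div 2 + t mod 4 mod 2 = min_parts t"
    "4 * (t div 4) + 2 * (t mod 4 div 2) + t mod 4 mod 2 = t"
    unfolding min_parts_def by simp_all
  then show ?case by blast
next
  case (step c)
  then obtain c0 c1 c2 where c: "c0 + c1 + c2 = c" "4 * c0 + 2 * c1 + c2 = t"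
    by auto
  \<comment> \<open>With fewer than t parts, not all are 1; splitting 4 = 2 + 2 or 2 = 1 + 1 adds
    one part.\<close>
  consider "c0 > 0" | "c0 = 0" "c1 > 0"
    using c step.prems by force
  then show ?case
  proof cases
    case 1
    then have "(c0 - 1) + (c1 + 2) + c2 = Suc c" "4 * (c0 - 1) + 2 * (c1 + 2) + c2 = t"
      using c by auto
    then show ?thesis by blast
  next
    case 2
    then have "c0 + (c1 - 1) + (c2 + 2) = Suc c" "4 * c0 + 2 * (c1 - 1) + (c2 + 2) = t"
      using c by auto
    then show ?thesis by blast
  qed
qed

abbreviation recip_sum :: "nat multiset \<Rightarrow> real" where
  "recip_sum M \<equiv> (\<Sum>x\<in>#M. 1 / real x)"

lemma ex_block:
  assumes "k > 0" "min_parts t \<le> c" "c \<le> t"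
  shows "\<exists>M. size M = c \<and> (\<forall>x\<in>#M. x \<in> S k \<and> k ^ b dvd x) \<and> recip_sum M = t / (4 * real k ^ b)"
proof -
  obtain c0 c1 c2 where c: "c0 + c1 + c2 = c" "4 * c0 + 2 * c1 + c2 = t"
    using ex_parts[OF assms(2,3)] by blast
  define M where "M = replicate_mset c0 (2 ^ 0 * k ^ b) + replicate_mset c1 (2 ^ 1 * k ^ b)
    + replicate_mset c2 (2 ^ 2 * k ^ b)"
  have mem: "2 ^ a * k ^ b \<in> S k" if "a \<in> {0, 1, 2}" for a
    using that unfolding S_def by blast
  have "x \<in> S k \<and> k ^ b dvd x" if "x \<in># M" for x
  proof -
    from that consider "x = 2 ^ 0 * k ^ b" | "x = 2 ^ 1 * k ^ b" | "x = 2 ^ 2 * k ^ b"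
      unfolding M_def by (metis in_replicate_mset union_iff)
    then show ?thesis using mem by cases (metis dvd_triv_right insertCI)+
  qed
  moreover have "recip_sum M = t / (4 * real k ^ b)"
    using assms(1) unfolding M_def c(2)[symmetric] by (simp add: field_simps)
  moreover have "size M = c" using c(1) by (simp add: M_def)
  ultimately show ?thesis by blast
qed

lemma nontrivial_solution_of_mset:
  assumes "\<forall>x\<in>#M. x \<in> S k" "recip_sum M = 1" "\<exists>x\<in>#M. k dvd x"
  shows "\<exists>x. nontrivial_solution k (size M) x"
proof -
  define xs where "xs = sorted_list_of_multiset M"
  define x where "x = (\<lambda>i. xs ! (i - 1))"
  have xs: "mset xs = M" "sorted xs" by (simp_all add: xs_def)
  have len: "length xs = size M" using xs(1) by (metis size_mset)
  have in_M: "x i \<in># M" if "i \<in> {1..size M}" for i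
    using that len xs(1) unfolding x_def
    by (metis One_nat_def Suc_le_eq Suc_pred' atLeastAtMost_iff nth_mem_mset)
  have "mono_on {1..size M} x"
    using xs(2) len unfolding x_def by (intro mono_onI sorted_nth_mono) auto
  moreover have "(\<Sum>i=1..size M. 1 / real (x i)) = 1"
  proof -
    have "(\<Sum>i=1..size M. 1 / real (x i)) = (\<Sum>i<size M. 1 / real (xs ! i))"
      unfolding x_def by (rule sum.reindex_bij_witness[of _ Suc "\<lambda>i. i - 1"]) auto
    also have "\<dots> = (\<Sum>x\<leftarrow>xs. 1 / real x)"
      by (simp add: sum_list_sum_nth len atLeast0LessThan)
    also have "\<dots> = recip_sum M"
      by (metis mset_map sum_mset_sum_list xs(1))
    finally show ?thesis using assms(2) by simp
  qed
  moreover have "\<exists>i\<in>{1..size M}. k dvd x i"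
  proof -
    obtain y where "y \<in># M" "k dvd y" using assms(3) by blast
    then obtain i where "i < size M" "xs ! i = y"
      using xs(1) len by (metis in_set_conv_nth set_mset_mset)
    then show ?thesis
      using \<open>k dvd y\<close> by (intro bexI[of _ "Suc i"]) (auto simp: x_def)
  qed
  ultimately show ?thesis
    using in_M assms(1) unfolding nontrivial_solution_def is_solution_def by blast
qed

text \<open>The element \<open>4 * k ^ b\<close> is what makes the induction below continue: it can be expanded
  at exponent \<open>b + 1\<close>, and the expansion is chosen to contain \<open>4 * k ^ (b + 1)\<close>.\<close>

lemma ex_solution_mset:
  assumes k: "k \<ge> 3" and "min_parts k + 2 \<le> n"
  shows "\<exists>M b. size M = n \<and> (\<forall>x\<in>#M. x \<in> S k) \<and> recip_sum M = 1 \<and> (\<exists>x\<in>#M. k dvd x) \<and>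
    4 * k ^ b \<in># M"
  using assms(2)
proof (induction n rule: less_induct)
  case (less n)
  have S4: "4 * k ^ b \<in> S k" for b
    unfolding S_def by (rule CollectI) (intro exI[of _ 2] exI[of _ b], simp)
  show ?case
  \<comment> \<open>Here 1/2 + 1/4 is completed by k / (4k), written with n - 2 terms; the term 4 is
    the required \<open>4 * k ^ 0\<close>.\<close>
  proof (cases "n \<le> k + 2")
    case True
    obtain M where M: "size M = n - 2" "\<forall>x\<in>#M. x \<in> S k \<and> k ^ 1 dvd x"
      "recip_sum M = real k / (4 * k ^ 1)"
      using ex_block[of k k "n - 2" 1] less.prems True k by force
    have "M \<noteq> {#}" using M(3) k by auto
    then obtain y where "y \<in># M" by blast
    have "2 \<in> S k"
      unfolding S_def by (rule CollectI) (intro exI[of _ 1] exI[of _ 0], simp)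
    then show ?thesis
      using M less.prems k S4[of 0] \<open>y \<in># M\<close>
      by (intro exI[of _ "M + {#2, 4#}"] exI[of _ 0]) auto
  next
    case False
    \<comment> \<open>Since 1 / (4 k^b) = (1 + (k - 1)) / (4 k^(b+1)), replacing
      \<open>4 * k ^ b\<close> by \<open>4 * k ^ Suc b\<close> and a block of d terms raises the
      length by d. As n > k + 2, length n - d is still within the induction's range.\<close>
    define d where "d = min_parts (k - 1)"
    have d: "d > 0" "d + min_parts k + 2 \<le> n" "d \<le> k - 1"
      using k False min_parts_bounds[of k] min_parts_bounds[of "k - 1"]
      unfolding d_def by linarith+
    then have "n - d < n" "min_parts k + 2 \<le> n - d" using d by linarith+
    from less.IH[OF this]
    obtain M b where M: "size M = n - d" "\<forall>x\<in>#M. x \<in> S k" "recip_sum M = 1"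
      "4 * k ^ b \<in># M"
      by blast
    obtain M' where M': "M = add_mset (4 * k ^ b) M'"
      using M(4) by (metis multi_member_split)
    obtain N where N: "size N = d" "\<forall>x\<in>#N. x \<in> S k"
      "recip_sum N = real (k - 1) / (4 * k ^ Suc b)"
      using ex_block[of k "k - 1" d "Suc b"] d k unfolding d_def by auto
    have "recip_sum N + 1 / real (4 * k ^ Suc b) = 1 / real (4 * k ^ b)"
      using k unfolding N(3) by (simp add: field_simps of_nat_diff)
    then have "recip_sum (add_mset (4 * k ^ Suc b) (M' + N)) = 1"
      using M(3) unfolding M' by simp
    moreover have "size (add_mset (4 * k ^ Suc b) (M' + N)) = n"
      using M(1) N(1) d unfolding M' by simp
    moreover have "\<forall>x\<in>#add_mset (4 * k ^ Suc b) (M' + N). x \<in> S k"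
      using M(2) N(2) S4[of "Suc b"] unfolding M' by auto
    moreover have "k dvd 4 * k ^ Suc b" by simp
    ultimately show ?thesis
      by (intro exI[of _ "add_mset (4 * k ^ Suc b) (M' + N)"] exI[of _ "Suc b"]) auto
  qed
qed

section \<open>The exceptional solution and the closed form\<close>

lemma ex_nontrivial_solution_3_3: "\<exists>x. nontrivial_solution 3 3 x"
proof -
  have "2 ^ a * 3 ^ b \<in> S 3" if "a \<in> {0, 1, 2}" for a b
    using that unfolding S_def by blast
  from this[of 1 0] this[of 0 1] this[of 1 1]
  have "2 \<in> S 3" "3 \<in> S 3" "6 \<in> S 3" by simp_all
  then show ?thesis
    using nontrivial_solution_of_mset[of "{#2, 3, 6#}" 3] by (simp add: numeral_3_eq_3)
qed

lemma ex_nontrivial_solution_iff: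
  assumes "k \<ge> 3" "\<not> (\<exists>m::nat. k = 2 ^ m)"
  shows "(\<exists>x. nontrivial_solution k n x) \<longleftrightarrow> (k, n) = (3, 3) \<or> min_parts k + 2 \<le> n"
proof
  assume "\<exists>x. nontrivial_solution k n x"
  then have "min_length k \<le> n"
    using nontrivial_solution_imp_min_length_le[OF assms] by blast
  \<comment> \<open>For k = 3 the two bounds are 3 and 4, so n = 3 is the only extra length.\<close>
  then show "(k, n) = (3, 3) \<or> min_parts k + 2 \<le> n"
    by (auto simp: min_length_def min_parts_def split: if_splits)
next
  assume "(k, n) = (3, 3) \<or> min_parts k + 2 \<le> n"
  then show "\<exists>x. nontrivial_solution k n x"
    using ex_nontrivial_solution_3_3 ex_solution_mset[OF assms(1), of n]
      nontrivial_solution_of_mset by blast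
qed

theorem theorem7:
  fixes k n :: nat
  assumes "k > 0" and "\<not> (\<exists>m::nat. k = 2 ^ m)" and "n > 0"
  shows "(\<exists>x. nontrivial_solution k n x) \<longleftrightarrow>
    (k, n) = (3, 3) \<or>
    real n \<ge> (if k mod 4 = 0 then (real k + 8) / 4
               else if k mod 4 = 1 then (real k + 11) / 4
               else if k mod 4 = 2 then (real k + 10) / 4
               else (real k + 13) / 4)"
proof -
  have "k \<noteq> 2 ^ 0" "k \<noteq> 2 ^ 1" using assms(2) by blast+
  then have "k \<ge> 3" using assms(1) by simp
  define q where "q = k div 4"
  have k: "k = 4 * q + k mod 4" by (simp add: q_def)
  have "k mod 4 < 4" by simp
  then consider "k mod 4 = 0" | "k mod 4 = 1" | "k mod 4 = 2" | "k mod 4 = 3" by linarith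
  \<comment> \<open>On each residue class the stated fraction is an integer, equal to
    \<open>min_parts k + 2\<close>.\<close>
  then have "min_parts k + 2 \<le> n \<longleftrightarrow>
    real n \<ge> (if k mod 4 = 0 then (real k + 8) / 4
               else if k mod 4 = 1 then (real k + 11) / 4
               else if k mod 4 = 2 then (real k + 10) / 4
               else (real k + 13) / 4)"
  proof cases
    case 1
    with k have "real k = 4 * real q" by linarith
    with 1 show ?thesis unfolding min_parts_def q_def[symmetric] by auto
  next
    case 2
    with k have "real k = 4 * real q + 1" by linarith
    with 2 show ?thesis unfolding min_parts_def q_def[symmetric] by auto
  next
    case 3
    with k have "real k = 4 * real q + 2" by linarith
    with 3 show ?thesis unfolding min_parts_def q_def[symmetric] by auto
  next
    case 4
    with k have "real k = 4 * real q + 3" by linarith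
    with 4 show ?thesis unfolding min_parts_def q_def[symmetric] by auto
  qed
  then show ?thesis
    using ex_nontrivial_solution_iff[OF \<open>k \<ge> 3\<close> assms(2), of n] by simp
qed

end
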